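(* Let $p,n\in\mathbb{N}$, $j=\begin{bmatrix} I_p&0\\0&-I_p\end{bmatrix}$, and let $\beta(x)$ be a differentiable $p\times2p$ matrix function on $[0,T]$ ($T<\infty$) or on $[0,\infty)$, with $H(x)=\beta(x)^*\beta(x)$. Let $\mathcal{A}$ be an invertible $n\times n$ matrix, $\mathcal{S}(0)=\mathcal{S}(0)^*$ an $n\times n$ matrix and $\Lambda(0)$ an $n\times2p$ matrix with $$\mathcal{A}\mathcal{S}(0)-\mathcal{S}(0)\mathcal{A}^*=\mathrm{i}\Lambda(0)j\Lambda(0)^*,$$ let $w_{\mathcal{A}}(x,\lambda)$ be the associated transfer matrix function defined in the context, and let $\widetilde\beta(x)=\beta(x)w_{\mathcal{A}}(x,0)$. Assume that $$\beta(x)j\beta(x)^*=0 .$$ Then (at the points where $\mathcal{S}(x)$ is invertible) $\widetilde\beta(x)$ satisfies $$\widetilde\beta(x)j\widetilde\beta(x)^*=0,\qquad \widetilde\beta'(x)j\widetilde\beta(x)^*=\beta'(x)j\beta(x)^*.$$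
   Context: $^*$ is the conjugate transpose, $'$ is $d/dx$. The $n\times2p$ matrix function $\Lambda(x)$ and the $n\times n$ matrix function $\mathcal{S}(x)=\mathcal{S}(x)^*$ are determined by their initial values $\Lambda(0)$, $\mathcal{S}(0)$ and the equations $$\Lambda'(x)=-\mathrm{i}\mathcal{A}\Lambda(x)jH(x),\qquad \mathcal{S}'(x)=\Lambda(x)jH(x)j\Lambda(x)^*,$$ and, at the points where $\mathcal{S}(x)$ is invertible, $$w_{\mathcal{A}}(x,\lambda)=I_{2p}-\mathrm{i}j\Lambda(x)^*\mathcal{S}(x)^{-1}(\mathcal{A}-\lambda I_n)^{-1}\Lambda(x).$$ *)

theory Defs
  imports "HOL-Analysis.Analysis"
begin

definition conj_transpose :: "complex ^ 'm ^ 'n \<Rightarrow> complex ^ 'n ^ 'm"  (\<open>(_\<^sup>\<star>)\<close> [1000] 1000)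
  where "A\<^sup>\<star> = map_matrix cnj (transpose A)"

definition mat_scale :: "complex \<Rightarrow> complex ^ 'm ^ 'n \<Rightarrow> complex ^ 'm ^ 'n"  (infixr \<open>*m\<close> 75)
  where "c *m A = map_matrix (\<lambda>u. c * u) A"

text \<open>Matrices with \<open>2 p\<close> rows or columns are indexed by the disjoint sum \<open>'p + 'p\<close>, whose two
  summands are the two blocks of size \<open>p\<close>.\<close>

definition jmat :: "complex ^ ('p::finite + 'p) ^ ('p + 'p)"
  where "jmat = (\<chi> a b. if a = b then (case a of Inl _ \<Rightarrow> 1 | Inr _ \<Rightarrow> - 1) else 0)"

definition hamiltonian ::
    "(real \<Rightarrow> complex ^ ('p::finite + 'p) ^ 'p) \<Rightarrow> real \<Rightarrow> complex ^ ('p + 'p) ^ ('p + 'p)"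
  where "hamiltonian \<beta> x = (\<beta> x)\<^sup>\<star> ** \<beta> x"

text \<open>Meaningful only where \<open>S x\<close> and \<open>A - z I\<close> are invertible, since \<open>matrix_inv\<close> is
  unspecified on singular matrices.\<close>

definition transfer_matrix ::
    "complex ^ 'n ^ 'n \<Rightarrow> (real \<Rightarrow> complex ^ 'n ^ 'n) \<Rightarrow> (real \<Rightarrow> complex ^ ('p::finite + 'p) ^ 'n)
      \<Rightarrow> real \<Rightarrow> complex \<Rightarrow> complex ^ ('p + 'p) ^ ('p + 'p)"
  where "transfer_matrix A S \<Lambda> x z =
    mat 1 - \<i> *m (jmat ** (\<Lambda> x)\<^sup>\<star> ** matrix_inv (S x) ** matrix_inv (A - z *m mat 1) ** \<Lambda> x)"

end

theory Submission
  imports Defs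
begin

text \<open>Write \<open>J\<close> for the signature matrix, \<open>w\<close> for the transfer matrix at \<open>\<lambda> = 0\<close> and
  \<open>Q = \<Lambda>\<^sup>\<star> S\<inverse> \<Lambda>\<close>.  Two facts about \<open>w\<close>, valid for any self-adjoint \<open>H\<close>, carry the proof.

  First, \<open>w J w\<^sup>\<star> = J\<close> wherever \<open>S\<close> is invertible (lemma \<open>transfer_matrix_J_unitary\<close>).  It
  rests on the identity \<open>A S - S A\<^sup>\<star> = \<i> \<Lambda> J \<Lambda>\<^sup>\<star>\<close> and on \<open>S\<^sup>\<star> = S\<close>; both are given at \<open>0\<close> and
  persist on the whole interval, because the differential equations make the difference of their
  two sides have derivative zero (\<open>matrix_identity_preserved\<close> and \<open>selfadjoint_preserved\<close>).  This
  already gives \<open>(\<beta> w) J (\<beta> w)\<^sup>\<star> = \<beta> J \<beta>\<^sup>\<star> = 0\<close>.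

  Second, \<open>w\<close> solves the linear equation \<open>w' = J (H J Q - Q J H) w\<close>
  (\<open>transfer_matrix_has_vector_derivative\<close>).  Together with the first fact,
  \<open>(\<beta> w)' J (\<beta> w)\<^sup>\<star> = \<beta>' J \<beta>\<^sup>\<star> + \<beta> J (H J Q - Q J H) J \<beta>\<^sup>\<star>\<close>, and for \<open>H = \<beta>\<^sup>\<star> \<beta>\<close> each of the two
  summands of the last term contains a factor \<open>\<beta> J \<beta>\<^sup>\<star> = 0\<close>, one at its left end and one at its
  right end.\<close>

section \<open>Algebra of complex matrices\<close>

text \<open>Both products are real bilinear maps in finite dimension, hence bounded; this one fact gives
  their distributive laws, their continuity and their product rules.\<close>

lemma bounded_bilinear_matrix_mult:
  "bounded_bilinear ((**) :: complex^'m::finite^'n::finite \<Rightarrow> complex^'k::finite^'m \<Rightarrow> complex^'k^'n)"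
  unfolding bilinear_conv_bounded_bilinear[symmetric] bilinear_def
  by (auto intro!: linearI simp: vec_eq_iff matrix_matrix_mult_def scaleR_sum_right sum.distrib algebra_simps)

interpretation matrix_mult: bounded_bilinear
  "(**) :: complex^'m::finite^'n::finite \<Rightarrow> complex^'k::finite^'m \<Rightarrow> complex^'k^'n"
  by (rule bounded_bilinear_matrix_mult)

lemma bounded_bilinear_mat_scale:
  "bounded_bilinear ((*m) :: complex \<Rightarrow> complex^'m::finite^'n::finite \<Rightarrow> complex^'m^'n)"
  unfolding bilinear_conv_bounded_bilinear[symmetric] bilinear_def
  by (auto intro!: linearI simp: vec_eq_iff mat_scale_def map_matrix_def algebra_simps)

interpretation mat_scale: bounded_bilinear
  "(*m) :: complex \<Rightarrow> complex^'m::finite^'n::finite \<Rightarrow> complex^'m^'n"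
  by (rule bounded_bilinear_mat_scale)

lemma bounded_linear_conj_transpose:
  "bounded_linear (conj_transpose :: complex^'m::finite^'n::finite \<Rightarrow> complex^'n^'m)"
  unfolding linear_conv_bounded_linear[symmetric]
  by (auto intro!: linearI simp: vec_eq_iff conj_transpose_def map_matrix_def transpose_def)

lemmas conj_transpose_zero = linear_0[OF bounded_linear.linear[OF bounded_linear_conj_transpose]]
lemmas conj_transpose_minus = linear_neg[OF bounded_linear.linear[OF bounded_linear_conj_transpose]]
lemmas conj_transpose_diff = linear_diff[OF bounded_linear.linear[OF bounded_linear_conj_transpose]]

lemmas conj_transpose_has_vector_derivative =
  bounded_linear.has_vector_derivative[OF bounded_linear_conj_transpose]

lemma mat_scale_mult_left: "(c *m A) ** B = c *m (A ** B)"
  by (simp add: vec_eq_iff mat_scale_def map_matrix_def matrix_matrix_mult_def sum_distrib_left mult_ac)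

lemma mat_scale_mult_right: "A ** (c *m B) = c *m (A ** B)"
  by (simp add: vec_eq_iff mat_scale_def map_matrix_def matrix_matrix_mult_def sum_distrib_left mult_ac)

lemma mat_scale_mat_scale: "c *m (d *m A) = (c * d) *m A"
  by (simp add: vec_eq_iff mat_scale_def map_matrix_def mult_ac)

lemma mat_scale_one: "1 *m A = A"
  by (simp add: vec_eq_iff mat_scale_def map_matrix_def)

lemma conj_transpose_mult: "(A ** B)\<^sup>\<star> = B\<^sup>\<star> ** A\<^sup>\<star>"
  by (simp add: vec_eq_iff conj_transpose_def map_matrix_def transpose_def matrix_matrix_mult_def mult_ac)

lemma conj_transpose_mat_scale: "(c *m A)\<^sup>\<star> = cnj c *m A\<^sup>\<star>"
  by (simp add: vec_eq_iff conj_transpose_def map_matrix_def transpose_def mat_scale_def)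

lemma conj_transpose_conj_transpose: "(A\<^sup>\<star>)\<^sup>\<star> = A"
  by (simp add: vec_eq_iff conj_transpose_def map_matrix_def transpose_def)

lemma conj_transpose_one: "(mat 1)\<^sup>\<star> = mat 1"
  by (simp add: vec_eq_iff conj_transpose_def map_matrix_def transpose_def mat_def)

lemma conj_transpose_jmat: "jmat\<^sup>\<star> = jmat"
  by (auto simp: vec_eq_iff conj_transpose_def map_matrix_def transpose_def jmat_def split: sum.splits)

lemma jmat_squared: "jmat ** jmat = mat 1"
  by (auto simp: vec_eq_iff matrix_matrix_mult_def jmat_def mat_def if_distrib[of "\<lambda>x. x * _"]
      cong: if_cong split: sum.splits)

text \<open>Used as rewrite rules, these turn an expression into a linear combination of words in its
  matrices, bracketed to the right.\<close>

lemmas matrix_expand =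
  matrix_mult.add_left matrix_mult.add_right matrix_mult.diff_left matrix_mult.diff_right
  matrix_mult.minus_left matrix_mult.minus_right
  mat_scale.add_right mat_scale.diff_right mat_scale.minus_left mat_scale.minus_right
  mat_scale_mult_left mat_scale_mult_right mat_scale_mat_scale mat_scale_one
  matrix_mult.zero_left matrix_mult.zero_right mat_scale.zero_left mat_scale.zero_right
  conj_transpose_zero conj_transpose_minus conj_transpose_diff conj_transpose_mult conj_transpose_mat_scale
  conj_transpose_conj_transpose conj_transpose_one conj_transpose_jmat
  matrix_mul_assoc[symmetric]

lemma jmat_jmat_mult: "jmat ** (jmat ** X) = X"
  by (simp add: matrix_mul_assoc jmat_squared)

lemma matrix_inv_mult:
  assumes "invertible A"
  shows "A ** matrix_inv A = mat 1" "matrix_inv A ** A = mat 1"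
  using someI_ex[OF assms[unfolded invertible_def]] by (auto simp: matrix_inv_def)

lemma conj_transpose_matrix_inv:
  assumes "invertible M" "M\<^sup>\<star> = M"
  shows "(matrix_inv M)\<^sup>\<star> = matrix_inv M"
proof -
  have "(matrix_inv M)\<^sup>\<star> ** M = mat 1"
    using arg_cong[OF matrix_inv_mult(1)[OF assms(1)], of conj_transpose] assms(2)
    by (simp add: conj_transpose_mult conj_transpose_one)
  then have "(matrix_inv M)\<^sup>\<star> ** M ** matrix_inv M = matrix_inv M"
    by simp
  then show ?thesis
    by (simp add: matrix_inv_mult assms flip: matrix_mul_assoc)
qed

section \<open>Continuity and derivative of the matrix inverse\<close>

lemma tendsto_det:
  fixes f :: "'a \<Rightarrow> complex^'n::finite^'n"
  assumes "\<And>i j. ((\<lambda>x. f x $ i $ j) \<longlongrightarrow> B $ i $ j) F"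
  shows "((\<lambda>x. det (f x)) \<longlongrightarrow> det B) F"
  unfolding det_def by (intro tendsto_intros assms)

text \<open>Cramer's rule writes every entry of the inverse as a quotient of determinants, so that
  continuity of inversion follows from continuity of the determinant.\<close>

lemma matrix_inv_cramer:
  fixes A :: "complex^'n::finite^'n"
  assumes "invertible A"
  shows "matrix_inv A $ k $ l = det (\<chi> i j. if j = k then axis l 1 $ i else A $ i $ j) / det A"
proof -
  have "A *v (matrix_inv A *v axis l 1) = axis l 1"
    by (simp add: matrix_vector_mul_assoc matrix_inv_mult assms)
  then have "matrix_inv A *v axis l 1 =
      (\<chi> k. det (\<chi> i j. if j = k then axis l 1 $ i else A $ i $ j) / det A)"
    using assms by (simp add: cramer invertible_det_nz)
  moreover have "(matrix_inv A *v axis l 1) $ k = matrix_inv A $ k $ l"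
    by (simp add: matrix_vector_mult_def axis_def if_distrib cong: if_cong)
  ultimately show ?thesis
    by simp
qed

lemma eventually_invertible:
  fixes f :: "'a \<Rightarrow> complex^'n::finite^'n"
  assumes "(f \<longlongrightarrow> B) F" "invertible B"
  shows "\<forall>\<^sub>F x in F. invertible (f x)"
  using tendsto_imp_eventually_ne[OF tendsto_det, of f B F 0] assms
  by (simp add: invertible_det_nz tendsto_vec_nth)

lemma tendsto_matrix_inv:
  fixes f :: "'a \<Rightarrow> complex^'n::finite^'n"
  assumes f: "(f \<longlongrightarrow> B) F" and B: "invertible B"
  shows "((\<lambda>x. matrix_inv (f x)) \<longlongrightarrow> matrix_inv B) F"
proof (intro vec_tendstoI)
  fix k l
  have "((\<lambda>x. det (\<chi> i j. if j = k then axis l 1 $ i else f x $ i $ j) / det (f x))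
      \<longlongrightarrow> det (\<chi> i j. if j = k then axis l 1 $ i else B $ i $ j) / det B) F"
    using B by (intro tendsto_divide tendsto_det) (auto simp: invertible_det_nz intro!: tendsto_vec_nth f)
  then show "((\<lambda>x. matrix_inv (f x) $ k $ l) \<longlongrightarrow> matrix_inv B $ k $ l) F"
    unfolding matrix_inv_cramer[OF B]
    by (rule tendsto_cong[THEN iffD2, rotated])
      (use eventually_invertible[OF assms] in eventually_elim, simp add: matrix_inv_cramer)
qed


lemma has_vector_derivative_iff_tendsto_quotient:
  "(f has_vector_derivative D) (at x within I) \<longleftrightarrow>
    ((\<lambda>y. (f y - f x) /\<^sub>R (y - x)) \<longlongrightarrow> D) (at x within I)"
proof -
  have "(f has_vector_derivative D) (at x within I) \<longleftrightarrow>
      ((\<lambda>y. norm (f y - f x - (y - x) *\<^sub>R D) / norm (y - x)) \<longlongrightarrow> 0) (at x within I)"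
    by (simp add: has_vector_derivative_def has_derivative_iff_norm bounded_linear_scaleR_left)
  also have "\<dots> \<longleftrightarrow> ((\<lambda>y. norm ((f y - f x) /\<^sub>R (y - x) - D)) \<longlongrightarrow> 0) (at x within I)"
  proof (rule Lim_cong_within[OF refl refl refl])
    fix y assume "y \<noteq> x"
    then have "(f y - f x) /\<^sub>R (y - x) - D = (f y - f x - (y - x) *\<^sub>R D) /\<^sub>R (y - x)"
      by (simp add: scaleR_diff_right)
    then show "norm (f y - f x - (y - x) *\<^sub>R D) / norm (y - x) = norm ((f y - f x) /\<^sub>R (y - x) - D)"
      by (simp add: divide_inverse mult.commute)
  qed
  also have "\<dots> \<longleftrightarrow> ((\<lambda>y. (f y - f x) /\<^sub>R (y - x)) \<longlongrightarrow> D) (at x within I)"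
    by (simp add: tendsto_norm_zero_iff LIM_zero_iff)
  finally show ?thesis .
qed

text \<open>The difference quotient of the inverse is
  \<open>- S(y)\<inverse> ((S(y) - S(x)) / (y - x)) S(x)\<inverse>\<close>, so continuity of inversion is all that the limit
  requires.\<close>

lemma has_vector_derivative_matrix_inv:
  fixes S :: "real \<Rightarrow> complex^'n::finite^'n"
  assumes S: "(S has_vector_derivative D) (at x within I)" and inv: "invertible (S x)"
  shows "((\<lambda>y. matrix_inv (S y)) has_vector_derivative
    - (matrix_inv (S x) ** D ** matrix_inv (S x))) (at x within I)"
  unfolding has_vector_derivative_iff_tendsto_quotient
proof -
  let ?U = "\<lambda>y. matrix_inv (S y)"
  have lim: "(S \<longlongrightarrow> S x) (at x within I)"
    using has_vector_derivative_continuous[OF S] by (simp add: continuous_within)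
  have "((\<lambda>y. - (?U y ** ((S y - S x) /\<^sub>R (y - x)) ** ?U x)) \<longlongrightarrow> - (?U x ** D ** ?U x)) (at x within I)"
    by (intro tendsto_minus matrix_mult.tendsto tendsto_const tendsto_matrix_inv[OF lim inv]
        S[unfolded has_vector_derivative_iff_tendsto_quotient])
  moreover have "\<forall>\<^sub>F y in at x within I.
      - (?U y ** ((S y - S x) /\<^sub>R (y - x)) ** ?U x) = (?U y - ?U x) /\<^sub>R (y - x)"
    using eventually_invertible[OF lim inv]
  proof eventually_elim
    case (elim y)
    have "?U y ** S y ** ?U x = ?U x" "?U y ** S x ** ?U x = ?U y"
      using elim inv by (simp_all add: matrix_inv_mult flip: matrix_mul_assoc)
    then have "- (?U y ** (S y - S x) ** ?U x) = ?U y - ?U x"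
      by (simp add: matrix_mult.diff_left matrix_mult.diff_right)
    then show ?case
      by (simp add: matrix_mult.scaleR_left matrix_mult.scaleR_right flip: scaleR_minus_right)
  qed
  ultimately show "((\<lambda>y. (?U y - ?U x) /\<^sub>R (y - x)) \<longlongrightarrow> - (?U x ** D ** ?U x)) (at x within I)"
    by (rule tendsto_cong[THEN iffD1, rotated])
qed


section \<open>Identities preserved along the flow\<close>

text \<open>The right-hand side of the equation for \<open>S\<close> is self-adjoint, so \<open>S\<^sup>\<star> - S\<close> has derivative
  zero.\<close>

lemma selfadjoint_preserved:
  fixes S :: "real \<Rightarrow> complex^'n::finite^'n" and \<Lambda> :: "real \<Rightarrow> complex^('p::finite + 'p)^'n"
  assumes I: "convex I" "0 \<in> I" "x \<in> I"
    and H: "\<And>x. x \<in> I \<Longrightarrow> (H x)\<^sup>\<star> = H x"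
    and S0: "(S 0)\<^sup>\<star> = S 0"
    and S: "\<And>x. x \<in> I \<Longrightarrow>
      (S has_vector_derivative \<Lambda> x ** jmat ** H x ** jmat ** (\<Lambda> x)\<^sup>\<star>) (at x within I)"
  shows "(S x)\<^sup>\<star> = S x"
proof -
  have "((\<lambda>x. (S x)\<^sup>\<star> - S x) has_vector_derivative 0) (at x within I)" if "x \<in> I" for x
    using has_vector_derivative_diff[OF conj_transpose_has_vector_derivative[OF S] S, OF that that]
    by (simp add: matrix_expand H that)
  then obtain c where "\<And>x. x \<in> I \<Longrightarrow> (S x)\<^sup>\<star> - S x = c"
    using has_vector_derivative_zero_constant[OF \<open>convex I\<close>] by blast
  from this[OF \<open>0 \<in> I\<close>] this[OF \<open>x \<in> I\<close>] S0 show ?thesis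
    by simp
qed

text \<open>Both sides have derivative \<open>A \<Lambda> J H J \<Lambda>\<^sup>\<star> - \<Lambda> J H J \<Lambda>\<^sup>\<star> A\<^sup>\<star>\<close>.\<close>

lemma matrix_identity_preserved:
  fixes S :: "real \<Rightarrow> complex^'n::finite^'n" and \<Lambda> :: "real \<Rightarrow> complex^('p::finite + 'p)^'n"
  assumes I: "convex I" "0 \<in> I" "x \<in> I"
    and H: "\<And>x. x \<in> I \<Longrightarrow> (H x)\<^sup>\<star> = H x"
    and initial: "A ** S 0 - S 0 ** A\<^sup>\<star> = \<i> *m (\<Lambda> 0 ** jmat ** (\<Lambda> 0)\<^sup>\<star>)"
    and \<Lambda>: "\<And>x. x \<in> I \<Longrightarrow>
      (\<Lambda> has_vector_derivative (- \<i>) *m (A ** \<Lambda> x ** jmat ** H x)) (at x within I)"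
    and S: "\<And>x. x \<in> I \<Longrightarrow>
      (S has_vector_derivative \<Lambda> x ** jmat ** H x ** jmat ** (\<Lambda> x)\<^sup>\<star>) (at x within I)"
  shows "A ** S x - S x ** A\<^sup>\<star> = \<i> *m (\<Lambda> x ** jmat ** (\<Lambda> x)\<^sup>\<star>)"
proof -
  define R where "R x = A ** S x - S x ** A\<^sup>\<star> - \<i> *m (\<Lambda> x ** jmat ** (\<Lambda> x)\<^sup>\<star>)" for x
  have "(R has_vector_derivative 0) (at x within I)" if x: "x \<in> I" for x
    unfolding R_def
    by (rule has_vector_derivative_eq_rhs,
        (rule has_vector_derivative_diff matrix_mult.has_vector_derivative
          mat_scale.has_vector_derivative conj_transpose_has_vector_derivative
          has_vector_derivative_const \<Lambda>[OF x] S[OF x])+)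
      (simp add: matrix_expand H x)
  then obtain c where "\<And>x. x \<in> I \<Longrightarrow> R x = c"
    using has_vector_derivative_zero_constant[OF \<open>convex I\<close>] by blast
  from this[OF \<open>0 \<in> I\<close>] this[OF \<open>x \<in> I\<close>] initial show ?thesis
    by (simp add: R_def)
qed

section \<open>The transfer matrix at zero\<close>

lemma transfer_matrix_zero:
  "transfer_matrix A S \<Lambda> x 0 =
    mat 1 - \<i> *m (jmat ** (\<Lambda> x)\<^sup>\<star> ** matrix_inv (S x) ** matrix_inv A ** \<Lambda> x)"
  by (simp add: transfer_matrix_def mat_scale.zero_left)

text \<open>Expanding \<open>w J w\<^sup>\<star>\<close> gives \<open>J\<close>, two terms linear in \<open>U V = S\<inverse> A\<inverse>\<close> and its adjoint, and a term
  with the middle factor \<open>U V \<Lambda> J \<Lambda>\<^sup>\<star> V\<^sup>\<star> U\<close>.  The identity for \<open>A S - S A\<^sup>\<star>\<close>, multiplied by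
  \<open>U V\<close> from the left and \<open>V\<^sup>\<star> U\<close> from the right, expresses that middle factor by
  \<open>V\<^sup>\<star> U - U V\<close>, and then everything but \<open>J\<close> cancels.\<close>

lemma transfer_matrix_J_unitary:
  fixes S :: "real \<Rightarrow> complex^'n::finite^'n" and \<Lambda> :: "real \<Rightarrow> complex^('p::finite + 'p)^'n"
  assumes A: "invertible A" and Sx: "invertible (S x)" and adj: "(S x)\<^sup>\<star> = S x"
    and identity: "A ** S x - S x ** A\<^sup>\<star> = \<i> *m (\<Lambda> x ** jmat ** (\<Lambda> x)\<^sup>\<star>)"
  shows "transfer_matrix A S \<Lambda> x 0 ** jmat ** (transfer_matrix A S \<Lambda> x 0)\<^sup>\<star> = jmat"
proof -
  define U V L where "U = matrix_inv (S x)" and "V = matrix_inv A" and "L = \<Lambda> x"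
  have U: "U ** S x = mat 1" "S x ** U = mat 1" "U\<^sup>\<star> = U"
    using Sx adj by (simp_all add: U_def matrix_inv_mult conj_transpose_matrix_inv)
  have V: "V ** A = mat 1" "A ** V = mat 1"
    using A by (simp_all add: V_def matrix_inv_mult)
  have AV: "A\<^sup>\<star> ** V\<^sup>\<star> = mat 1"
    using arg_cong[OF V(1), of conj_transpose] by (simp add: conj_transpose_mult conj_transpose_one)
  have "\<i> *m (U ** V ** (L ** jmat ** L\<^sup>\<star>) ** V\<^sup>\<star> ** U) =
      U ** V ** (A ** S x - S x ** A\<^sup>\<star>) ** V\<^sup>\<star> ** U"
    by (simp add: identity L_def mat_scale_mult_left mat_scale_mult_right)
  also have "\<dots> = U ** (V ** A) ** S x ** V\<^sup>\<star> ** U - U ** V ** S x ** (A\<^sup>\<star> ** V\<^sup>\<star>) ** U"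
    by (simp add: matrix_expand)
  also have "\<dots> = V\<^sup>\<star> ** U - U ** V"
    unfolding V AV by (simp add: U matrix_mul_assoc) (simp add: U flip: matrix_mul_assoc)
  finally have "- \<i> *m (\<i> *m (U ** V ** (L ** jmat ** L\<^sup>\<star>) ** V\<^sup>\<star> ** U)) =
      - \<i> *m (V\<^sup>\<star> ** U - U ** V)"
    by simp
  then have K: "U ** V ** (L ** jmat ** L\<^sup>\<star>) ** V\<^sup>\<star> ** U = - \<i> *m (V\<^sup>\<star> ** U - U ** V)"
    by (simp add: mat_scale_mat_scale mat_scale_one)
  have w: "transfer_matrix A S \<Lambda> x 0 = mat 1 - \<i> *m (jmat ** L\<^sup>\<star> ** U ** V ** L)"
    by (simp add: transfer_matrix_zero U_def V_def L_def)
  have "transfer_matrix A S \<Lambda> x 0 ** jmat ** (transfer_matrix A S \<Lambda> x 0)\<^sup>\<star> =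
      jmat - \<i> *m (jmat ** L\<^sup>\<star> ** (U ** V - V\<^sup>\<star> ** U) ** L ** jmat)
        + jmat ** L\<^sup>\<star> ** (U ** V ** (L ** jmat ** L\<^sup>\<star>) ** V\<^sup>\<star> ** U) ** L ** jmat"
    unfolding w by (simp add: matrix_expand U jmat_squared jmat_jmat_mult)
  also have "\<dots> = jmat"
    unfolding K by (simp add: matrix_expand)
  finally show ?thesis .
qed

text \<open>The product rule produces \<open>H J \<Lambda>\<^sup>\<star> A\<^sup>\<star> S\<inverse> A\<inverse> \<Lambda>\<close>, from the derivative of \<open>\<Lambda>\<^sup>\<star>\<close>.  The
  identity for \<open>A S - S A\<^sup>\<star>\<close> moves \<open>A\<^sup>\<star>\<close> across \<open>S\<inverse>\<close>, where it cancels against \<open>A\<inverse>\<close>; the price is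
  a further term, which completes \<open>H J Q\<close> to \<open>H J Q w\<close>.  The derivatives of \<open>S\<inverse>\<close> and \<open>\<Lambda>\<close>
  combine to the summand with \<open>Q J H w\<close>.\<close>

lemma transfer_matrix_has_vector_derivative:
  fixes S :: "real \<Rightarrow> complex^'n::finite^'n" and \<Lambda> :: "real \<Rightarrow> complex^('p::finite + 'p)^'n"
  assumes A: "invertible A" and Sx: "invertible (S x)"
    and H: "(H x)\<^sup>\<star> = H x"
    and identity: "A ** S x - S x ** A\<^sup>\<star> = \<i> *m (\<Lambda> x ** jmat ** (\<Lambda> x)\<^sup>\<star>)"
    and \<Lambda>: "(\<Lambda> has_vector_derivative (- \<i>) *m (A ** \<Lambda> x ** jmat ** H x)) (at x within I)"
    and S: "(S has_vector_derivative \<Lambda> x ** jmat ** H x ** jmat ** (\<Lambda> x)\<^sup>\<star>) (at x within I)"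
  defines "Q \<equiv> (\<Lambda> x)\<^sup>\<star> ** matrix_inv (S x) ** \<Lambda> x"
  shows "((\<lambda>y. transfer_matrix A S \<Lambda> y 0) has_vector_derivative
    jmat ** (H x ** jmat ** Q - Q ** jmat ** H x) ** transfer_matrix A S \<Lambda> x 0) (at x within I)"
proof -
  define U V L where "U = matrix_inv (S x)" and "V = matrix_inv A" and "L = \<Lambda> x"
  have U: "U ** S x = mat 1" "S x ** U = mat 1"
    using Sx by (simp_all add: U_def matrix_inv_mult)
  have V: "V ** A = mat 1" "A ** V = mat 1"
    using A by (simp_all add: V_def matrix_inv_mult)
  have "U ** (A ** S x - S x ** A\<^sup>\<star>) ** U ** V = \<i> *m (U ** L ** jmat ** L\<^sup>\<star> ** U ** V)"
    by (simp add: identity L_def mat_scale_mult_left mat_scale_mult_right matrix_mul_assoc)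
  moreover have "U ** (A ** S x - S x ** A\<^sup>\<star>) ** U ** V = 
      U ** A ** (S x ** U) ** V - (U ** S x) ** A\<^sup>\<star> ** U ** V"
    by (simp add: matrix_expand)
  moreover have "\<dots> = U ** (A ** V) - A\<^sup>\<star> ** U ** V"
    unfolding U by (simp add: matrix_mul_assoc)
  ultimately have "A\<^sup>\<star> ** U ** V = U - \<i> *m (U ** L ** jmat ** L\<^sup>\<star> ** U ** V)"
    by (simp add: V algebra_simps)
  from arg_cong[OF this, of "\<lambda>X. X ** L"]
  have AUV: "A\<^sup>\<star> ** (U ** (V ** L)) =
      U ** L - \<i> *m (U ** (L ** (jmat ** (L\<^sup>\<star> ** (U ** (V ** L))))))"
    by (simp add: matrix_expand)
  have VA: "V ** (A ** X) = X" for X :: "complex^('p + 'p)^'n"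
    by (simp add: matrix_mul_assoc V)
  show ?thesis
    unfolding transfer_matrix_zero
    by (rule has_vector_derivative_eq_rhs,
        (rule has_vector_derivative_diff matrix_mult.has_vector_derivative
          mat_scale.has_vector_derivative conj_transpose_has_vector_derivative
          has_vector_derivative_const has_vector_derivative_matrix_inv \<Lambda> S Sx)+)
      (simp add: Q_def H AUV VA matrix_expand flip: U_def V_def L_def)
qed

section \<open>Transformed neutral functions\<close>

theorem proposition6p1:
  fixes I :: "real set"
    and \<beta> \<beta>t :: "real \<Rightarrow> complex ^ ('p::finite + 'p) ^ 'p"
    and A :: "complex ^ 'n::finite ^ 'n"
    and S :: "real \<Rightarrow> complex ^ 'n ^ 'n"
    and \<Lambda> :: "real \<Rightarrow> complex ^ ('p + 'p) ^ 'n"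
  assumes interval: "(\<exists>T>0. I = {0..T}) \<or> I = {0..}"
    and beta_diff: "\<beta> differentiable_on I"
    and A_inv: "invertible A"
    and S0_selfadjoint: "(S 0)\<^sup>\<star> = S 0"
    and initial_identity: "A ** S 0 - S 0 ** A\<^sup>\<star> = \<i> *m (\<Lambda> 0 ** jmat ** (\<Lambda> 0)\<^sup>\<star>)"
    and Lambda_ode: "\<And>x. x \<in> I \<Longrightarrow>
      (\<Lambda> has_vector_derivative (- \<i>) *m (A ** \<Lambda> x ** jmat ** hamiltonian \<beta> x)) (at x within I)"
    and S_ode: "\<And>x. x \<in> I \<Longrightarrow>
      (S has_vector_derivative \<Lambda> x ** jmat ** hamiltonian \<beta> x ** jmat ** (\<Lambda> x)\<^sup>\<star>) (at x within I)"
    and beta_tilde: "\<And>x. x \<in> I \<Longrightarrow> invertible (S x) \<Longrightarrow>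
      \<beta>t x = \<beta> x ** transfer_matrix A S \<Lambda> x 0"
    and beta_neutral: "\<And>x. x \<in> I \<Longrightarrow> \<beta> x ** jmat ** (\<beta> x)\<^sup>\<star> = 0"
  shows "\<forall>x\<in>I. invertible (S x) \<longrightarrow>
      \<beta>t x ** jmat ** (\<beta>t x)\<^sup>\<star> = 0 \<and>
      \<beta>t differentiable (at x within I) \<and>
      vector_derivative \<beta>t (at x within I) ** jmat ** (\<beta>t x)\<^sup>\<star> =
        vector_derivative \<beta> (at x within I) ** jmat ** (\<beta> x)\<^sup>\<star>"
proof (intro ballI impI)
  fix x assume x: "x \<in> I" and Sx: "invertible (S x)"
  let ?w = "\<lambda>y. transfer_matrix A S \<Lambda> y 0" and ?H = "hamiltonian \<beta>"
  define Q where "Q = (\<Lambda> x)\<^sup>\<star> ** matrix_inv (S x) ** \<Lambda> x"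
  have I: "convex I" "0 \<in> I" "\<And>a. I \<noteq> {a}"
  proof -
    show "convex I" "0 \<in> I"
      using interval by auto
    fix a :: real
    have "\<exists>b\<in>I. b \<noteq> 0"
      using interval
    proof
      assume "\<exists>T>0. I = {0..T}"
      then obtain T where "T > 0" "I = {0..T}"
        by blast
      then show ?thesis
        by (intro bexI[of _ T]) auto
    qed (auto intro!: bexI[of _ 1])
    then show "I \<noteq> {a}"
      using \<open>0 \<in> I\<close> by auto
  qed
  \<comment> \<open>The derivative of \<open>\<beta>t\<close> within \<open>I\<close> is unique only because \<open>x\<close> is not an isolated point.\<close>
  have nontrivial: "at x within I \<noteq> bot"
    using connected_imp_perfect[OF convex_connected[OF I(1)] x I(3)]
    by (simp add: trivial_limit_within)
  have H: "(?H y)\<^sup>\<star> = ?H y" for y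
    by (simp add: hamiltonian_def conj_transpose_mult conj_transpose_conj_transpose)
  have adj: "(S x)\<^sup>\<star> = S x"
    by (rule selfadjoint_preserved[where S = S and \<Lambda> = \<Lambda> and H = ?H, OF I(1,2) x H S0_selfadjoint S_ode])
  have identity: "A ** S x - S x ** A\<^sup>\<star> = \<i> *m (\<Lambda> x ** jmat ** (\<Lambda> x)\<^sup>\<star>)"
    by (rule matrix_identity_preserved
        [where S = S and \<Lambda> = \<Lambda> and H = ?H, OF I(1,2) x H initial_identity Lambda_ode S_ode])
  have wJw: "?w x ** jmat ** (?w x)\<^sup>\<star> = jmat"
    by (rule transfer_matrix_J_unitary[where S = S and \<Lambda> = \<Lambda> and x = x, OF A_inv Sx adj identity])
  have sandwich: "M ** ?w x ** jmat ** (\<beta>t x)\<^sup>\<star> = M ** jmat ** (\<beta> x)\<^sup>\<star>"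
    for M :: "complex^('p + 'p)^'p"
  proof -
    have "M ** ?w x ** jmat ** (\<beta>t x)\<^sup>\<star> = M ** (?w x ** jmat ** (?w x)\<^sup>\<star>) ** (\<beta> x)\<^sup>\<star>"
      by (simp add: beta_tilde[OF x Sx] conj_transpose_mult matrix_mul_assoc)
    then show ?thesis
      by (simp add: wJw)
  qed
  have dw: "(?w has_vector_derivative jmat ** (?H x ** jmat ** Q - Q ** jmat ** ?H x) ** ?w x)
      (at x within I)"
    unfolding Q_def
    by (rule transfer_matrix_has_vector_derivative
        [where S = S and \<Lambda> = \<Lambda> and H = ?H and x = x, OF A_inv Sx H identity Lambda_ode[OF x] S_ode[OF x]])
  have d\<beta>: "(\<beta> has_vector_derivative vector_derivative \<beta> (at x within I)) (at x within I)"
    using beta_diff x by (simp add: differentiable_on_def vector_derivative_works)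
  define D where "D = \<beta> x ** (jmat ** (?H x ** jmat ** Q - Q ** jmat ** ?H x) ** ?w x)
      + vector_derivative \<beta> (at x within I) ** ?w x"
  \<comment> \<open>The formula for \<open>\<beta>t\<close> is known only where \<open>S\<close> is invertible; continuity of \<open>S\<close> makes this
    hold near \<open>x\<close>, which is enough to differentiate it.\<close>
  have "(S \<longlongrightarrow> S x) (at x within I)"
    using has_vector_derivative_continuous[OF S_ode[OF x]] by (simp add: continuous_within)
  from eventually_invertible[OF this Sx]
  obtain d where "d > 0" and d: "\<And>y. y \<in> I \<Longrightarrow> dist y x < d \<Longrightarrow> invertible (S y)"
    using Sx unfolding eventually_at by metis
  have d\<beta>t: "(\<beta>t has_vector_derivative D) (at x within I)"
    by (rule has_vector_derivative_transform_within
        [OF matrix_mult.has_vector_derivative[OF d\<beta> dw, folded D_def] \<open>d > 0\<close> x])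
      (simp add: beta_tilde d)
  have neutral: "\<beta> x ** (jmat ** ((\<beta> x)\<^sup>\<star> ** X)) = 0" for X :: "complex^'p^'p"
    using beta_neutral[OF x] by (simp add: matrix_mul_assoc matrix_mult.zero_left)
  have neutral': "\<beta> x ** (jmat ** (\<beta> x)\<^sup>\<star>) = 0"
    using beta_neutral[OF x] by (simp add: matrix_mul_assoc)
  have "D = (\<beta> x ** jmat ** (?H x ** jmat ** Q - Q ** jmat ** ?H x)
      + vector_derivative \<beta> (at x within I)) ** ?w x"
    by (simp add: D_def matrix_mult.add_left matrix_mul_assoc)
  \<comment> \<open>Both terms of the middle factor die by neutrality of \<open>\<beta> x\<close>, as \<open>H = \<beta>\<^sup>\<star> \<beta>\<close> meets
    \<open>\<beta> J\<close> on its left in the first and \<open>J \<beta>\<^sup>\<star>\<close> on its right in the second.\<close>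
  then have "D ** jmat ** (\<beta>t x)\<^sup>\<star> = vector_derivative \<beta> (at x within I) ** jmat ** (\<beta> x)\<^sup>\<star>"
    by (simp only: sandwich) (simp add: matrix_expand hamiltonian_def neutral neutral')
  moreover have "\<beta>t x ** jmat ** (\<beta>t x)\<^sup>\<star> = 0"
    using sandwich[of "\<beta> x"] by (simp add: beta_neutral[OF x] beta_tilde[OF x Sx])
  moreover have "\<beta>t differentiable (at x within I)"
    using d\<beta>t by (auto simp: has_vector_derivative_def differentiable_def)
  ultimately show "\<beta>t x ** jmat ** (\<beta>t x)\<^sup>\<star> = 0 \<and>
      \<beta>t differentiable (at x within I) \<and>
      vector_derivative \<beta>t (at x within I) ** jmat ** (\<beta>t x)\<^sup>\<star> =
        vector_derivative \<beta> (at x within I) ** jmat ** (\<beta> x)\<^sup>\<star>"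
    using vector_derivative_within[OF nontrivial d\<beta>t] by simp
qed

end
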